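(* There exists a sequence of graphs $(G_h)_{h\geq 1}$ such that $\mathrm{cont}(G_h)/\mathrm{lin}(G_h)\to\infty$ as $h\to\infty$.
   Context: All graphs are finite, simple, loopless and undirected; $N[x]$ denotes the closed neighbourhood of a vertex $x$. The (closed) contiguity $\mathrm{cont}(G)$ of a graph $G=(V,E)$ is the minimum $k$ such that there exists a linear order $\sigma$ on $V$ for which, for every vertex $x$, $N[x]$ is a union of at most $k$ intervals of $\sigma$. A closed $p$-line-model of $G$ is a tuple $(\sigma_1,\ldots,\sigma_p)$ of linear orders on $V$ such that for every $x\in V$ there exist intervals $I_i$ of $\sigma_i$ ($1\le i\le p$, possibly empty, not necessarily disjoint) with $N[x]=\bigcup_{i=1}^p I_i$; the (closed) linearity $\mathrm{lin}(G)$ is the minimum such $p$. *)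

theory Defs
  imports Complex_Main "Graph_Theory.Pair_Digraph"
begin

text \<open>
  A finite simple loopless undirected graph is a \<^locale>\<open>pair_graph\<close>: finite vertex
  set \<^const>\<open>pverts\<close> and a symmetric, irreflexive adjacency relation \<^const>\<open>parcs\<close>.
\<close>

definition closed_nbhd :: "'a pair_pre_digraph \<Rightarrow> 'a \<Rightarrow> 'a set" where
  "closed_nbhd G x = insert x {y. (x, y) \<in> parcs G}"

text \<open>
  Intervals of a linear order \<open>r\<close> on \<open>V\<close> are its sets of consecutive elements, i.e. the
  order-convex subsets of \<open>V\<close>; the empty set is included.
\<close>

definition interval_in :: "'a set \<Rightarrow> 'a rel \<Rightarrow> 'a set \<Rightarrow> bool" where
  "interval_in V r I \<longleftrightarrow>
     I \<subseteq> V \<and> (\<forall>x\<in>I. \<forall>z\<in>I. \<forall>y\<in>V. (x, y) \<in> r \<and> (y, z) \<in> r \<longrightarrow> y \<in> I)"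

definition k_interval_order :: "'a pair_pre_digraph \<Rightarrow> nat \<Rightarrow> 'a rel \<Rightarrow> bool" where
  "k_interval_order G k r \<longleftrightarrow>
     linear_order_on (pverts G) r \<and>
     (\<forall>x\<in>pverts G. \<exists>\<I>. finite \<I> \<and> card \<I> \<le> k \<and>
        (\<forall>I\<in>\<I>. interval_in (pverts G) r I) \<and> closed_nbhd G x = \<Union>\<I>)"

definition contiguity :: "'a pair_pre_digraph \<Rightarrow> nat" where
  "contiguity G = (LEAST k. \<exists>r. k_interval_order G k r)"

text \<open>The tuple of orders is given by the values of \<open>r\<close> on \<open>{1..p}\<close>.\<close>

definition line_model :: "'a pair_pre_digraph \<Rightarrow> nat \<Rightarrow> (nat \<Rightarrow> 'a rel) \<Rightarrow> bool" where
  "line_model G p r \<longleftrightarrow>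
     (\<forall>i\<in>{1..p}. linear_order_on (pverts G) (r i)) \<and>
     (\<forall>x\<in>pverts G. \<exists>I. (\<forall>i\<in>{1..p}. interval_in (pverts G) (r i) (I i)) \<and>
        closed_nbhd G x = (\<Union>i\<in>{1..p}. I i))"

definition linearity :: "'a pair_pre_digraph \<Rightarrow> nat" where
  "linearity G = (LEAST p. \<exists>r. line_model G p r)"

text \<open>Both minima are attained, so neither \<open>LEAST\<close> is degenerate.\<close>

lemma closed_nbhd_subset:
  assumes "pair_graph G" "x \<in> pverts G"
  shows "closed_nbhd G x \<subseteq> pverts G"
proof -
  interpret pair_graph G by fact
  show ?thesis
    using assms(2) in_arcsD2 by (auto simp: closed_nbhd_def)
qed

lemma interval_in_singleton:
  assumes "linear_order_on V r" "v \<in> V"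
  shows "interval_in V r {v}"
proof -
  have "antisym r"
    using assms(1) by (simp add: linear_order_on_def partial_order_on_def)
  then show ?thesis
    using assms(2) unfolding interval_in_def antisym_def by blast
qed

lemma contiguity_attained:
  assumes "pair_graph G"
  shows "\<exists>r. k_interval_order G (contiguity G) r"
proof -
  interpret pair_graph G by fact
  obtain r where r: "linear_order_on (pverts G) r"
    using well_order_on[of "pverts G"] by (auto simp: well_order_on_def)
  have "k_interval_order G (card (pverts G)) r"
    unfolding k_interval_order_def
  proof (intro conjI ballI r)
    fix x assume "x \<in> pverts G"
    then have sub: "closed_nbhd G x \<subseteq> pverts G"
      by (rule closed_nbhd_subset[OF assms])
    show "\<exists>\<I>. finite \<I> \<and> card \<I> \<le> card (pverts G) \<and>
        (\<forall>I\<in>\<I>. interval_in (pverts G) r I) \<and> closed_nbhd G x = \<Union>\<I>"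
    proof (intro exI[of _ "(\<lambda>v. {v}) ` closed_nbhd G x"] conjI)
      show "finite ((\<lambda>v. {v}) ` closed_nbhd G x)"
        using finite_subset[OF sub pair_finite_verts] by (rule finite_imageI)
      show "card ((\<lambda>v. {v}) ` closed_nbhd G x) \<le> card (pverts G)"
        using card_mono[OF pair_finite_verts sub] by (simp add: card_image)
      show "\<forall>I\<in>(\<lambda>v. {v}) ` closed_nbhd G x. interval_in (pverts G) r I"
        using sub interval_in_singleton[OF r] by blast
    qed blast
  qed
  then have "\<exists>k. \<exists>r. k_interval_order G k r"
    by blast
  then show ?thesis
    unfolding contiguity_def by (rule LeastI_ex)
qed

lemma linearity_attained:
  assumes "pair_graph G"
  shows "\<exists>r. line_model G (linearity G) r"
proof -
  interpret pair_graph G by fact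
  obtain r where r: "linear_order_on (pverts G) r"
    using well_order_on[of "pverts G"] by (auto simp: well_order_on_def)
  obtain f where f: "bij_betw f {1..card (pverts G)} (pverts G)"
    using ex_bij_betw_nat_finite_1[OF pair_finite_verts] by blast
  have "line_model G (card (pverts G)) (\<lambda>_. r)"
    unfolding line_model_def
  proof (intro conjI ballI r)
    fix x assume "x \<in> pverts G"
    then have sub: "closed_nbhd G x \<subseteq> f ` {1..card (pverts G)}"
      using closed_nbhd_subset assms f by (metis bij_betw_imp_surj_on)
    show "\<exists>I. (\<forall>i\<in>{1..card (pverts G)}. interval_in (pverts G) r (I i)) \<and>
        closed_nbhd G x = (\<Union>i\<in>{1..card (pverts G)}. I i)"
    proof (intro exI[of _ "\<lambda>i. {f i} \<inter> closed_nbhd G x"] conjI ballI)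
      fix i assume "i \<in> {1..card (pverts G)}"
      then have "interval_in (pverts G) r {f i}"
        using f interval_in_singleton[OF r] bij_betwE by blast
      then show "interval_in (pverts G) r ({f i} \<inter> closed_nbhd G x)"
        by (cases "f i \<in> closed_nbhd G x") (auto simp: interval_in_def)
    qed (use sub in auto)
  qed
  then have "\<exists>p. \<exists>r. line_model G p r"
    by blast
  then show ?thesis
    unfolding linearity_def by (rule LeastI_ex)
qed

end

theory Submission
  imports Defs
begin

text \<open>
  Take the \<open>h \<times> h\<close> grid and add one vertex for each row and each column, adjacent to the \<open>h\<close>
  points on that line. Listing the grid once row by row and once column by column shows that the
  linearity is at most 3. In a single order, if every closed neighbourhood is a union of at most
  \<open>k\<close> intervals, the \<open>2 h\<close> lines use at most \<open>2 h k\<close> intervals altogether. If this is less than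
  \<open>h\<^sup>2\<close>, some grid point is the last grid point of none of them, so the next grid point lies
  both in its row and in its column, which is absurd. Hence the contiguity is at least \<open>h / 2\<close>.
\<close>

section \<open>The graph of grid points, rows and columns\<close>

text \<open>
  The grid point in row \<open>i\<close> and column \<open>j\<close> is the number \<open>i * h + j < h * h\<close>; row \<open>i\<close> is
  represented by the vertex \<open>h * h + i\<close> and column \<open>j\<close> by \<open>h * h + h + j\<close>.
\<close>

definition grid_incidence :: "nat \<Rightarrow> nat rel" where
  "grid_incidence h =
     {(x, y). x < h * h \<and> (y = h * h + x div h \<or> y = h * h + h + x mod h)}"

definition grid_graph :: "nat \<Rightarrow> nat pair_pre_digraph" where
  "grid_graph h =
     \<lparr>pverts = {..<h * h + 2 * h}, parcs = grid_incidence h \<union> (grid_incidence h)\<inverse>\<rparr>"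

lemma pverts_grid_graph [simp]: "pverts (grid_graph h) = {..<h * h + 2 * h}"
  by (simp add: grid_graph_def)

text \<open>Every pair leads from a grid point to a line vertex, so the symmetric closure has no
  loops and stays inside the vertex set.\<close>

lemma grid_incidence_bounds:
  assumes "(x, y) \<in> grid_incidence h"
  shows "x < h * h" "h * h \<le> y" "y < h * h + 2 * h"
proof -
  have x: "x < h * h" using assms by (simp add: grid_incidence_def)
  moreover from x have "0 < h" by (cases h) auto
  moreover from x have "x div h < h" by (simp add: less_mult_imp_div_less)
  moreover have "x mod h < h" using \<open>0 < h\<close> by simp
  ultimately show "x < h * h" "h * h \<le> y" "y < h * h + 2 * h"
    using assms by (auto simp: grid_incidence_def)
qed

lemma pair_graph_grid_graph: "pair_graph (grid_graph h)"
proof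
  have "grid_incidence h \<subseteq> {..<h * h} \<times> {..<h * h + 2 * h}"
    using grid_incidence_bounds by auto
  then show "finite (parcs (grid_graph h))"
    by (auto simp: grid_graph_def intro: finite_subset)
  show "symmetric (with_proj (grid_graph h))"
    by (auto simp: symmetric_def grid_graph_def intro: symI)
qed (use grid_incidence_bounds in \<open>fastforce simp: grid_graph_def\<close>)+

lemma closed_nbhd_point:
  assumes "x < h * h"
  shows "closed_nbhd (grid_graph h) x = {x, h * h + x div h, h * h + h + x mod h}"
  using assms by (auto simp: closed_nbhd_def grid_graph_def grid_incidence_def)

lemma closed_nbhd_row:
  assumes "i < h"
  shows "closed_nbhd (grid_graph h) (h * h + i) = insert (h * h + i) {x. x < h * h \<and> x div h = i}"
  using assms by (auto simp: closed_nbhd_def grid_graph_def grid_incidence_def)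

lemma closed_nbhd_column:
  assumes "j < h"
  shows "closed_nbhd (grid_graph h) (h * h + h + j)
    = insert (h * h + h + j) {x. x < h * h \<and> x mod h = j}"
proof -
  \<comment> \<open>Row vertices stop below \<open>h * h + h\<close>, so a column vertex is never
    adjacent to a point through the row clause.\<close>
  have "h * h + h + j \<noteq> h * h + x div h" if "x < h * h" for x
    using less_mult_imp_div_less[OF that] by simp
  then show ?thesis
    by (auto simp: closed_nbhd_def grid_graph_def grid_incidence_def)
qed

section \<open>Bounds on the linearity\<close>

text \<open>Orders are coded by natural-number keys, so that claims about intervals become
  inequalities between keys.\<close>

definition key_order :: "'a set \<Rightarrow> ('a \<Rightarrow> nat) \<Rightarrow> 'a rel" where
  "key_order V f = {(x, y). x \<in> V \<and> y \<in> V \<and> f x \<le> f y}"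

lemma linear_order_on_key_order:
  assumes "inj_on f V"
  shows "linear_order_on V (key_order V f)"
  using assms
  by (auto simp: key_order_def linear_order_on_def partial_order_on_def preorder_on_def
      refl_on_def trans_def antisym_def total_on_def inj_on_def)

lemma interval_in_key_order: "interval_in V (key_order V f) {x \<in> V. a \<le> f x \<and> f x < b}"
  by (auto simp: interval_in_def key_order_def)

lemma linearity_grid_graph_le: "linearity (grid_graph h) \<le> 3"
proof -
  define N where "N = h * h + 2 * h"
  define V where "V = {..<N}"
  \<comment> \<open>The column order: \<open>N\<close> exceeds every vertex, so division of
    \<open>f x\<close> by \<open>N\<close> gives quotient \<open>x mod h\<close> and remainder
    \<open>x\<close>. Line vertices fall into the same blocks, but after the grid points.\<close>
  define f where "f x = (x mod h) * N + x" for x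
  \<comment> \<open>Order 2 lists by columns, orders 1 and 3 numerically. The third order carries
    only singletons; it is there because a grid point has a closed neighbourhood of three
    elements.\<close>
  define r where "r i = key_order V (if i = 2 then f else id)" for i :: nat
  have f_mod: "f x mod N = x" if "x \<in> V" for x
    using that by (simp add: f_def V_def)
  have lin: "linear_order_on V (r i)" for i
    unfolding r_def using inj_on_inverseI[of V "\<lambda>n. n mod N" f] f_mod
    by (auto intro: linear_order_on_key_order)
  have row: "interval_in V (r 1) {x. x < h * h \<and> x div h = i}" if "i < h" for i
  proof -
    \<comment> \<open>The window of row \<open>i\<close> ends by \<open>h * h\<close>, so no line
      vertex enters it.\<close>
    have *: "i * h + h \<le> h * h"
      using that mult_le_mono1[of "Suc i" h h] by simp
    have **: "x div h = i \<longleftrightarrow> i * h \<le> x \<and> x < i * h + h" for x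
    proof
      assume "x div h = i"
      then have "x = i * h + x mod h"
        by (metis div_mult_mod_eq)
      moreover have "x mod h < h"
        using that by simp
      ultimately show "i * h \<le> x \<and> x < i * h + h"
        by linarith
    next
      assume "i * h \<le> x \<and> x < i * h + h"
      then show "x div h = i"
        by (intro div_nat_eqI) (simp_all add: mult.commute)
    qed
    have "{x. x < h * h \<and> x div h = i} = {x \<in> V. i * h \<le> id x \<and> id x < i * h + h}"
      unfolding ** using * by (auto simp: V_def N_def)
    then show ?thesis
      using interval_in_key_order[of V id "i * h" "i * h + h"] by (simp add: r_def)
  qed
  have column: "interval_in V (r 2) {x. x < h * h \<and> x mod h = j}" if "j < h" for j
  proof -
    \<comment> \<open>Stopping after \<open>h * h\<close> keys instead of \<open>N\<close> cuts off
      the line vertices whose number is congruent to \<open>j\<close> modulo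
      \<open>h\<close>.\<close>
    have "x < h * h \<and> x mod h = j \<longleftrightarrow> j * N \<le> f x \<and> f x < j * N + h * h" if "x \<in> V" for x
    proof
      assume *: "j * N \<le> f x \<and> f x < j * N + h * h"
      then have "f x div N = j"
        using \<open>x \<in> V\<close> by (intro div_nat_eqI) (auto simp: V_def N_def algebra_simps)
      moreover have "f x div N = x mod h"
        using \<open>x \<in> V\<close> by (simp add: f_def V_def)
      ultimately show "x < h * h \<and> x mod h = j"
        using * by (simp add: f_def)
    qed (auto simp: f_def)
    moreover have "{x. x < h * h} \<subseteq> V"
      by (auto simp: V_def N_def)
    ultimately have "{x. x < h * h \<and> x mod h = j} = {x \<in> V. j * N \<le> f x \<and> f x < j * N + h * h}"
      by blast
    then show ?thesis
      using interval_in_key_order[of V f "j * N" "j * N + h * h"] by (simp add: r_def)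
  qed
  have sing: "interval_in V (r i) {v}" if "v \<in> V" for i v
    using interval_in_singleton[OF lin that] .
  have three: "{1..3} = {1, 2, 3::nat}" by auto
  have nbhd: "\<exists>I. (\<forall>i\<in>{1..3}. interval_in V (r i) (I i)) \<and>
      closed_nbhd (grid_graph h) x = (\<Union>i\<in>{1..3}. I i)" if "x \<in> V" for x
  proof -
    have witness: ?thesis
      if "interval_in V (r 1) A" "interval_in V (r 2) B" "interval_in V (r 3) C"
        "closed_nbhd (grid_graph h) x = A \<union> B \<union> C" for A B C
      using that unfolding three
      by (intro exI[of _ "\<lambda>i. if i = 1 then A else if i = 2 then B else C"]) auto
    consider "x < h * h" | i where "i < h" "x = h * h + i" | j where "j < h" "x = h * h + h + j"
    proof -
      have "x < h * h \<or> (\<exists>i<h. x = h * h + i) \<or> (\<exists>j<h. x = h * h + h + j)"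
        using \<open>x \<in> V\<close> unfolding V_def N_def by simp presburger
      then show thesis using that by blast
    qed
    then show ?thesis
    proof cases
      case 1
      have "closed_nbhd (grid_graph h) x \<subseteq> V"
        using closed_nbhd_subset[OF pair_graph_grid_graph] \<open>x \<in> V\<close> by (simp add: V_def N_def)
      then have "h * h + x div h \<in> V" "h * h + h + x mod h \<in> V"
        by (auto simp: closed_nbhd_point[OF 1])
      with \<open>x \<in> V\<close> show ?thesis
        by (intro witness[of "{x}" "{h * h + x div h}" "{h * h + h + x mod h}"] sing)
          (auto simp: closed_nbhd_point[OF 1])
    next
      case 2
      \<comment> \<open>The two orders that do not carry the row repeat \<open>{x}\<close>, as the
        intervals need not be disjoint.\<close>
      with \<open>x \<in> V\<close> show ?thesis
        by (intro witness[of "{x. x < h * h \<and> x div h = i}" "{x}" "{x}"] sing row)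
          (auto simp: closed_nbhd_row)
    next
      case 3
      with \<open>x \<in> V\<close> show ?thesis
        by (intro witness[of "{x}" "{x. x < h * h \<and> x mod h = j}" "{x}"] sing column)
          (auto simp: closed_nbhd_column)
    qed
  qed
  have "line_model (grid_graph h) 3 r"
    using lin nbhd by (simp add: line_model_def V_def N_def)
  then show ?thesis
    unfolding linearity_def by (intro Least_le) blast
qed

text \<open>An empty union cannot contain the vertex \<open>x\<close> of its own closed
  neighbourhood. Positivity keeps the final quotient from being a division by zero.\<close>

lemma linearity_pos:
  assumes "pair_graph G" "pverts G \<noteq> {}"
  shows "0 < linearity G"
proof (rule ccontr)
  assume "\<not> 0 < linearity G"
  then obtain r where "line_model G 0 r"
    using linearity_attained[OF assms(1)] by auto
  with assms(2) show False
    by (auto simp: line_model_def closed_nbhd_def)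
qed

section \<open>Lower bound on the contiguity\<close>

text \<open>Pigeonhole: otherwise each \<open>p\<close> in \<open>P\<close> is the last element of
  \<open>P\<close> in some member \<open>g p\<close> of \<open>U\<close>. Last elements are unique,
  so \<open>g\<close> would inject \<open>P\<close> into \<open>U\<close>.\<close>

lemma ex_not_last:
  assumes r: "linear_order_on V r" and P: "P \<subseteq> V"
    and U: "finite U" "card U < card P"
  shows "\<exists>p\<in>P. \<forall>I\<in>U. p \<in> I \<longrightarrow> (\<exists>q\<in>I \<inter> P. (p, q) \<in> r \<and> q \<noteq> p)"
proof (rule ccontr)
  assume "\<not> ?thesis"
  then obtain g where g: "\<And>p. p \<in> P \<Longrightarrow> g p \<in> U \<and> p \<in> g p \<and>
      (\<forall>q\<in>g p \<inter> P. (p, q) \<in> r \<longrightarrow> q = p)"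
    by metis
  have "inj_on g P"
  proof (rule inj_onI)
    fix p q assume pq: "p \<in> P" "q \<in> P" "g p = g q"
    then have "p = q \<or> (p, q) \<in> r \<or> (q, p) \<in> r"
      using r P unfolding linear_order_on_def total_on_def by blast
    moreover have "q \<in> g p \<inter> P" "p \<in> g q \<inter> P"
      using g[of p] g[of q] pq by simp_all
    ultimately show "p = q"
      using g pq by metis
  qed
  then have "card P \<le> card U"
    using g U(1) by (intro card_inj_on_le[of g]) auto
  with U(2) show False by simp
qed

text \<open>The earlier of \<open>q\<close> and \<open>q'\<close> lies between \<open>p\<close> and
  the other one, hence in both intervals by convexity. Carrying \<open>P\<close> along makes the
  common element a grid point in the application.\<close>

lemma intervals_share_next:
  assumes r: "linear_order_on V r" and I: "interval_in V r I" and J: "interval_in V r J"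
    and p: "p \<in> I" "p \<in> J"
    and q: "q \<in> I \<inter> P" "(p, q) \<in> r" "q \<noteq> p"
    and q': "q' \<in> J \<inter> P" "(p, q') \<in> r" "q' \<noteq> p"
  shows "\<exists>s\<in>I \<inter> J \<inter> P. s \<noteq> p"
proof -
  have "q \<in> V" "q' \<in> V"
    using I J q q' by (auto simp: interval_in_def)
  then have "q = q' \<or> (q, q') \<in> r \<or> (q', q) \<in> r"
    using r by (auto simp: linear_order_on_def total_on_def)
  then have "q \<in> J \<or> q' \<in> I"
    using I J p q q' \<open>q \<in> V\<close> \<open>q' \<in> V\<close> unfolding interval_in_def by blast
  then show ?thesis
    using q q' by blast
qed

lemma contiguity_grid_graph_ge: "h \<le> 2 * contiguity (grid_graph h)"
proof (rule ccontr)
  define k where "k = contiguity (grid_graph h)"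
  define V where "V = pverts (grid_graph h)"
  \<comment> \<open>The \<open>2 * h\<close> row and column vertices.\<close>
  define L where "L = {h * h..<h * h + 2 * h}"
  assume "\<not> ?thesis"
  then have k: "2 * k < h" by (simp add: k_def)
  obtain r where "k_interval_order (grid_graph h) k r"
    using contiguity_attained[OF pair_graph_grid_graph] unfolding k_def by blast
  then have r: "linear_order_on V r"
    and "\<forall>x\<in>V. \<exists>\<I>. finite \<I> \<and> card \<I> \<le> k \<and>
      (\<forall>I\<in>\<I>. interval_in V r I) \<and> closed_nbhd (grid_graph h) x = \<Union>\<I>"
    by (auto simp: k_interval_order_def V_def)
  then obtain F where F: "\<And>x. x \<in> V \<Longrightarrow> finite (F x) \<and> card (F x) \<le> k \<and>
      (\<forall>I\<in>F x. interval_in V r I) \<and> closed_nbhd (grid_graph h) x = \<Union>(F x)"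
    by metis
  have "L \<subseteq> V" by (auto simp: L_def V_def)
  then have F_L: "finite (F x)" "card (F x) \<le> k" if "x \<in> L" for x
    using F that by auto
  have "card (\<Union>x\<in>L. F x) \<le> (\<Sum>x\<in>L. card (F x))"
    by (intro card_UN_le) (simp add: L_def)
  also have "\<dots> \<le> card L * k"
    using sum_bounded_above[of L "\<lambda>x. card (F x)" k] F_L by simp
  also have "\<dots> = (2 * k) * h" by (simp add: L_def)
  also have "\<dots> < card {..<h * h}" using k by simp
  finally have "card (\<Union>x\<in>L. F x) < card {..<h * h}" .
  moreover have "finite (\<Union>x\<in>L. F x)"
    using F_L by (auto simp: L_def)
  ultimately obtain p where p: "p < h * h"
    and next_p: "\<And>I. I \<in> (\<Union>x\<in>L. F x) \<Longrightarrow> p \<in> I \<Longrightarrow>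
      \<exists>q\<in>I \<inter> {..<h * h}. (p, q) \<in> r \<and> q \<noteq> p"
    using ex_not_last[OF r, of "{..<h * h}" "\<Union>x\<in>L. F x"] by (auto simp: V_def)
  have bounds: "p div h < h" "p mod h < h"
    using p k by (auto simp: less_mult_imp_div_less)
  have in_L: "h * h + p div h \<in> L" "h * h + h + p mod h \<in> L"
    using bounds by (auto simp: L_def)
  have "p \<in> \<Union>(F (h * h + p div h))"
    using F[of "h * h + p div h"] in_L \<open>L \<subseteq> V\<close> p closed_nbhd_row[OF bounds(1)] by auto
  then obtain I where I: "I \<in> F (h * h + p div h)" "p \<in> I" by blast
  have "p \<in> \<Union>(F (h * h + h + p mod h))"
    using F[of "h * h + h + p mod h"] in_L \<open>L \<subseteq> V\<close> p closed_nbhd_column[OF bounds(2)] by auto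
  then obtain J where J: "J \<in> F (h * h + h + p mod h)" "p \<in> J" by blast
  have "interval_in V r I" "interval_in V r J"
    using F I J in_L \<open>L \<subseteq> V\<close> by blast+
  moreover obtain q where "q \<in> I \<inter> {..<h * h}" "(p, q) \<in> r" "q \<noteq> p"
    using next_p[of I] I in_L by blast
  moreover obtain q' where "q' \<in> J \<inter> {..<h * h}" "(p, q') \<in> r" "q' \<noteq> p"
    using next_p[of J] J in_L by blast
  \<comment> \<open>This \<open>s\<close> is a second grid point on both the row and the column of
    \<open>p\<close>, whereas quotient and remainder by \<open>h\<close> determine a point.\<close>
  ultimately obtain s where s: "s \<in> I" "s \<in> J" "s < h * h" "s \<noteq> p"
    using intervals_share_next[OF r, of I J p q "{..<h * h}" q'] I J by auto
  have "s \<in> closed_nbhd (grid_graph h) (h * h + p div h)"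
    using F[of "h * h + p div h"] I s in_L \<open>L \<subseteq> V\<close> by auto
  then have "s div h = p div h"
    using s by (simp add: closed_nbhd_row[OF bounds(1)])
  moreover have "s \<in> closed_nbhd (grid_graph h) (h * h + h + p mod h)"
    using F[of "h * h + h + p mod h"] J s in_L \<open>L \<subseteq> V\<close> by auto
  then have "s mod h = p mod h"
    using s by (simp add: closed_nbhd_column[OF bounds(2)])
  ultimately have "s = p"
    by (metis div_mult_mod_eq)
  with s show False by simp
qed

theorem theorem2:
  shows "\<exists>G :: nat \<Rightarrow> nat pair_pre_digraph.
           (\<forall>h\<ge>1. pair_graph (G h) \<and> pverts (G h) \<noteq> {}) \<and>
           filterlim (\<lambda>h. real (contiguity (G h)) / real (linearity (G h))) at_top sequentially"
proof (intro exI[of _ grid_graph] conjI allI impI)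
  show "pair_graph (grid_graph h)" for h
    by (rule pair_graph_grid_graph)
  show nonempty: "pverts (grid_graph h) \<noteq> {}" if "1 \<le> h" for h
    using that by (auto simp: lessThan_empty_iff)
  \<comment> \<open>The 6 is the product of the 2 in \<open>h \<le> 2 * contiguity\<close> and the 3
    in \<open>linearity \<le> 3\<close>.\<close>
  have bound: "real h / 6 \<le> real (contiguity (grid_graph h)) / real (linearity (grid_graph h))"
    if "1 \<le> h" for h
  proof -
    have "real h / 6 \<le> real (contiguity (grid_graph h)) / 3"
      using contiguity_grid_graph_ge[of h] by simp
    also have "\<dots> \<le> real (contiguity (grid_graph h)) / real (linearity (grid_graph h))"
      using linearity_grid_graph_le[of h] linearity_pos[OF pair_graph_grid_graph nonempty[OF that]]
      by (intro divide_left_mono) auto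
    finally show ?thesis .
  qed
  have "filterlim (\<lambda>h. 1 / 6 * real h) at_top sequentially"
    by (rule filterlim_tendsto_pos_mult_at_top[OF tendsto_const _ filterlim_real_sequentially]) simp
  then show "filterlim (\<lambda>h. real (contiguity (grid_graph h)) / real (linearity (grid_graph h)))
      at_top sequentially"
    by (rule filterlim_at_top_mono) (use bound in \<open>auto intro!: eventually_sequentiallyI[of 1]\<close>)
qed

end
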